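(* Let $G$ be a graph and let $\mathcal{H}=\{H_x \mid x\in V(G)\}$ be a family of graphs indexed by the vertices of $G$. Let $G[\mathcal{H}]$ be the lexicographic product of $G$ and $\mathcal{H}$. Then: 1. If $G$ is totally disconnected, then $G[\mathcal{H}]$ is shellable if and only if $H_x$ is shellable for all $x\in V(G)$. 2. If $G[\mathcal{H}]$ is shellable, then $H_x$ is shellable for all $x\in V(G)$. 3. If $G[\mathcal{H}]$ is shellable, then for each edge $\{x,y\}$ of $G$, $H_x$ is complete or $H_y$ is complete.
   Context: All graphs are non-empty (at least one vertex), finite and simple. A graph is totally disconnected if it has no edges. The lexicographic product $G[\mathcal{H}]$ is the graph with vertex set $\bigcup_{x\in V(G)}\{(x,y)\mid y\in V(H_x)\}$ in which $(x,y)$ and $(x',y')$ are adjacent if either $x=x'$ and $y$ is adjacent to $y'$ in $H_x$, or $x$ is adjacent to $x'$ in $G$. The independence complex $\Delta_G$ of a graph $G$ is the simplicial complex on $V(G)$ whose faces are the independent sets of vertices of $G$; its facets are the maximal independent sets. A simplicial complex (not necessarily pure) is shellable if its facets can be ordered $F_1,\dots,F_m$ so that for all $1\le i<j\le m$ there exist $v\in F_j\setminus F_i$ and $\ell\in\{1,\dots,j-1\}$ with $F_j\setminus F_\ell=\{v\}$. A graph is shellable if its independence complex is shellable. *)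

theory Defs
  imports "Graph_Theory.Graph_Theory"
begin

text \<open>
  A finite simple graph is a \<open>pair_graph\<close>: finite, loop-free and symmetric, so that an undirected
  edge \<open>{u, v}\<close> is encoded by the two arcs \<open>(u, v)\<close> and \<open>(v, u)\<close>. The locale \<open>pair_graph\<close> allows the
  null graph, which is excluded here.
\<close>

definition nonempty_graph :: "'a pair_pre_digraph \<Rightarrow> bool" where
  "nonempty_graph G \<longleftrightarrow> pair_graph G \<and> pverts G \<noteq> {}"

definition totally_disconnected :: "'a pair_pre_digraph \<Rightarrow> bool" where
  "totally_disconnected G \<longleftrightarrow> parcs G = {}"

definition complete_graph :: "'a pair_pre_digraph \<Rightarrow> bool" where
  "complete_graph G \<longleftrightarrow> complete_digraph (card (pverts G)) (with_proj G)"

definition lex_product ::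
    "'a pair_pre_digraph \<Rightarrow> ('a \<Rightarrow> 'b pair_pre_digraph) \<Rightarrow> ('a \<times> 'b) pair_pre_digraph" where
  "lex_product G H =
     (let V = (SIGMA x : pverts G. pverts (H x)) in
      \<lparr> pverts = V,
        parcs = {((x, y), (x', y')) | x y x' y'.
                   (x, y) \<in> V \<and> (x', y') \<in> V \<and>
                   (x = x' \<and> (y, y') \<in> parcs (H x) \<or> (x, x') \<in> parcs G)} \<rparr>)"

definition independent_set :: "'a pair_pre_digraph \<Rightarrow> 'a set \<Rightarrow> bool" where
  "independent_set G S \<longleftrightarrow> S \<subseteq> pverts G \<and> (\<forall>u\<in>S. \<forall>v\<in>S. (u, v) \<notin> parcs G)"

text \<open>
  A simplicial complex on a finite vertex set is represented by its set of faces, the empty face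
  included.
\<close>

definition simplicial_complex :: "'a set \<Rightarrow> 'a set set \<Rightarrow> bool" where
  "simplicial_complex V \<Delta> \<longleftrightarrow>
     finite V \<and> \<Delta> \<subseteq> Pow V \<and> {} \<in> \<Delta> \<and> (\<forall>v\<in>V. {v} \<in> \<Delta>) \<and> (\<forall>F\<in>\<Delta>. \<forall>E. E \<subseteq> F \<longrightarrow> E \<in> \<Delta>)"

definition facets :: "'a set set \<Rightarrow> 'a set set" where
  "facets \<Delta> = {F \<in> \<Delta>. \<forall>E\<in>\<Delta>. F \<subseteq> E \<longrightarrow> E = F}"

text \<open>Shellings in the nonpure sense: the facets may have different dimensions.\<close>

definition shelling :: "'a set set \<Rightarrow> 'a set list \<Rightarrow> bool" where
  "shelling \<Delta> Fs \<longleftrightarrow>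
     distinct Fs \<and> set Fs = facets \<Delta> \<and>
     (\<forall>j < length Fs. \<forall>i < j. \<exists>v \<in> Fs ! j - Fs ! i. \<exists>l < j. Fs ! j - Fs ! l = {v})"

definition shellable :: "'a set set \<Rightarrow> bool" where
  "shellable \<Delta> \<longleftrightarrow> (\<exists>Fs. shelling \<Delta> Fs)"

definition independence_complex :: "'a pair_pre_digraph \<Rightarrow> 'a set set" where
  "independence_complex G = {S. independent_set G S}"

definition shellable_graph :: "'a pair_pre_digraph \<Rightarrow> bool" where
  "shellable_graph G \<longleftrightarrow> shellable (independence_complex G)"

lemma simplicial_complex_independence_complex:
  assumes "pair_graph G"
  shows "simplicial_complex (pverts G) (independence_complex G)"
proof -
  interpret pair_graph G by fact
  show ?thesis
    by (auto simp: simplicial_complex_def independence_complex_def independent_set_def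
          dest: no_loops)
qed

lemma nonempty_graph_lex_product:
  assumes "nonempty_graph G" and "\<And>x. x \<in> pverts G \<Longrightarrow> nonempty_graph (H x)"
  shows "nonempty_graph (lex_product G H)"
proof -
  interpret G: pair_graph G using assms(1) by (simp add: nonempty_graph_def)
  have H: "pair_graph (H x)" "pverts (H x) \<noteq> {}" if "x \<in> pverts G" for x
    using assms(2)[OF that] by (auto simp: nonempty_graph_def)
  have V: "pverts (lex_product G H) = (SIGMA x : pverts G. pverts (H x))"
    by (simp add: lex_product_def Let_def)
  have fin: "finite (pverts (lex_product G H))"
    unfolding V using H(1)
    by (auto intro!: finite_SigmaI simp: pair_graph_def pair_digraph_def pair_fin_digraph_def
          pair_fin_digraph_axioms_def)
  have sub: "parcs (lex_product G H) \<subseteq> pverts (lex_product G H) \<times> pverts (lex_product G H)"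
    by (auto simp: lex_product_def Let_def)
  have loop: "u \<noteq> v" if uv: "(u, v) \<in> parcs (lex_product G H)" for u v
  proof
    assume "u = v"
    with uv obtain x y where "x \<in> pverts G" "(y, y) \<in> parcs (H x) \<or> (x, x) \<in> parcs G"
      by (auto simp: lex_product_def Let_def)
    from H(1)[OF this(1)] interpret Hx: pair_graph "H x" .
    show False using \<open>(y, y) \<in> parcs (H x) \<or> (x, x) \<in> parcs G\<close> G.no_loops Hx.no_loops
      by fastforce
  qed
  have sym: "(v, u) \<in> parcs (lex_product G H)" if uv: "(u, v) \<in> parcs (lex_product G H)" for u v
  proof -
    obtain x y x' y' where *: "u = (x, y)" "v = (x', y')" by (cases u, cases v)
    have x: "x \<in> pverts G" using uv * by (auto simp: lex_product_def Let_def)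
    from H(1)[OF x] interpret Hx: pair_graph "H x" .
    show ?thesis using uv * G.arcs_symmetric Hx.arcs_symmetric
      by (auto simp: lex_product_def Let_def)
  qed
  have "pair_graph (lex_product G H)"
    using fin sub loop finite_subset[OF sub] sym
    by unfold_locales (auto simp: arcs_ends_conv symmetric_def intro!: symI)
  moreover have "pverts (lex_product G H) \<noteq> {}"
    unfolding V using assms(1) H(2) by (auto simp: nonempty_graph_def)
  ultimately show ?thesis by (simp add: nonempty_graph_def)
qed

end

theory Submission
  imports Defs
begin

text \<open>
  A set of vertices of the lexicographic product is read as a relation: \<open>Domain D\<close> is the projection
  of \<open>D\<close> to \<open>G\<close> and \<open>D `` {x}\<close> is the fibre of \<open>D\<close> over \<open>x\<close>. A facet of the independence complex
  of the product is a facet of \<open>G\<close> carrying a facet of \<open>H x\<close> over each of its points \<open>x\<close>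
  (\<open>facet_lex_product_iff\<close>). A shelling is handled through the position of each facet in it: a
  natural-valued rank on the facets. This avoids all bookkeeping with list indices when a shelling is
  restricted or when several shellings are combined.

  The three assertions then come about as follows.

  \<^item> If \<open>G\<close> has no edges, the facets of the product are the families of facets of all the \<open>H x\<close>, and
    the sum of ranks of the fibres is a shelling rank (\<open>shellable_disjoint_union\<close>): it refines the
    componentwise order, and a family \<open>F\<close> that is not componentwise below \<open>E\<close> can be improved in one
    component.

  \<^item> In general, fix a facet \<open>S\<close> of \<open>G\<close> through \<open>x\<close> and a facet of \<open>H y\<close> for each other \<open>y\<close> in \<open>S\<close>.
    This embeds the facets of \<open>H x\<close> into those of the product, and a shelling of the product restricts
    along the embedding (\<open>shellable_factor\<close>). The facet that the shelling supplies may leave the image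
    of the embedding only by avoiding the fibre over \<open>x\<close>, hence only if the facet of \<open>H x\<close> being added
    is a single point, and such a facet satisfies the shelling condition against every earlier one.

  \<^item> Let \<open>x\<close> and \<open>y\<close> be adjacent. If \<open>H x\<close> is not complete, some facet of the product has two points
    over \<open>x\<close>. Removing one vertex from such a facet leaves a point over \<open>x\<close>, so an earlier facet that
    contains the rest again has two points over \<open>x\<close>. Consequently the first facet with two points
    over \<open>x\<close> must be the first facet altogether (\<open>shellable_edge_complete\<close>). The same would hold for
    \<open>y\<close>, but no independent set has points over both ends of an edge.
\<close>

section \<open>Shellings as rank functions\<close>

text \<open>
  Ranks may tie, but then the condition is required in both directions: whichever way ties are broken,
  listing \<open>\<F>\<close> by increasing rank is a shelling. Allowing ties is what makes sums of ranks usable.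
\<close>

definition shelling_rank :: "('a set \<Rightarrow> nat) \<Rightarrow> 'a set set \<Rightarrow> bool" where
  "shelling_rank r \<F> \<longleftrightarrow>
     (\<forall>E\<in>\<F>. \<forall>F\<in>\<F>. E \<noteq> F \<and> r E \<le> r F \<longrightarrow>
        (\<exists>v \<in> F - E. \<exists>D\<in>\<F>. r D < r F \<and> F - D = {v}))"

lemma shelling_rankE:
  assumes "shelling_rank r \<F>" "E \<in> \<F>" "F \<in> \<F>" "E \<noteq> F" "r E \<le> r F"
  obtains v D where "v \<in> F" "v \<notin> E" "D \<in> \<F>" "r D < r F" "F - D = {v}"
  using assms unfolding shelling_rank_def by blast

text \<open>
  The rank is the position in the shelling. Injectivity is kept because \<open>shellable_factor\<close> uses an
  embedded facet of \<open>H x\<close> as the strictly earlier facet \<open>D\<close>, knowing only that its rank is not larger.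
\<close>

lemma shellable_imp_inj_shelling_rank:
  assumes "shellable \<Delta>"
  obtains r where "inj_on r (facets \<Delta>)" "shelling_rank r (facets \<Delta>)"
proof -
  obtain Fs where dist: "distinct Fs" and set: "set Fs = facets \<Delta>"
    and shell: "\<And>i j. j < length Fs \<Longrightarrow> i < j \<Longrightarrow>
      \<exists>v \<in> Fs ! j - Fs ! i. \<exists>l < j. Fs ! j - Fs ! l = {v}"
    using assms unfolding shellable_def shelling_def by blast
  define r where "r = the_inv_into {..<length Fs} ((!) Fs)"
  have inj: "inj_on ((!) Fs) {..<length Fs}"
    using dist by (simp add: inj_on_nth)
  have img: "(!) Fs ` {..<length Fs} = facets \<Delta>"
    using set by (auto simp: set_conv_nth)
  have r_nth: "r (Fs ! i) = i" if "i < length Fs" for i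
    using that inj by (simp add: r_def the_inv_into_f_f)
  have "inj_on r (facets \<Delta>)"
    unfolding r_def img[symmetric] by (rule inj_on_the_inv_into[OF inj])
  moreover have "shelling_rank r (facets \<Delta>)"
    unfolding shelling_rank_def
  proof (intro ballI impI)
    fix E F assume "E \<in> facets \<Delta>" "F \<in> facets \<Delta>" and *: "E \<noteq> F \<and> r E \<le> r F"
    then obtain i j where ij: "i < length Fs" "E = Fs ! i" "j < length Fs" "F = Fs ! j"
      unfolding img[symmetric] by auto
    with * have "i < j"
      by (metis le_neq_implies_less r_nth)
    with shell ij obtain v l where "v \<in> F - E" "l < j" "F - Fs ! l = {v}"
      by blast
    moreover have "Fs ! l \<in> facets \<Delta>" "r (Fs ! l) < r F"
      using \<open>l < j\<close> ij r_nth set by auto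
    ultimately show "\<exists>v \<in> F - E. \<exists>D\<in>facets \<Delta>. r D < r F \<and> F - D = {v}"
      by blast
  qed
  ultimately show ?thesis using that by blast
qed

lemma shelling_rank_imp_shellable:
  assumes "finite (facets \<Delta>)" "shelling_rank r (facets \<Delta>)"
  shows "shellable \<Delta>"
proof -
  obtain Es where Es: "set Es = facets \<Delta>" "distinct Es"
    using finite_distinct_list[OF assms(1)] by blast
  define Fs where "Fs = sort_key r Es"
  have Fs: "set Fs = facets \<Delta>" "distinct Fs" "sorted (map r Fs)"
    using Es by (simp_all add: Fs_def)
  have "\<exists>v \<in> Fs ! j - Fs ! i. \<exists>l < j. Fs ! j - Fs ! l = {v}"
    if "j < length Fs" "i < j" for i j
  proof -
    have mono: "r (Fs ! k) \<le> r (Fs ! l)" if "k \<le> l" "l < length Fs" for k l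
      using sorted_nth_mono[OF Fs(3)] that by simp
    have facet: "Fs ! i \<in> facets \<Delta>" "Fs ! j \<in> facets \<Delta>" and neq: "Fs ! i \<noteq> Fs ! j"
      using Fs(2) that by (auto simp: nth_eq_iff_index_eq simp flip: Fs(1))
    have "r (Fs ! i) \<le> r (Fs ! j)"
      using mono that by simp
    from shelling_rankE[OF assms(2) facet neq this]
    obtain v D where D: "v \<in> Fs ! j" "v \<notin> Fs ! i" "D \<in> facets \<Delta>"
        "r D < r (Fs ! j)" "Fs ! j - D = {v}" .
    then obtain l where l: "l < length Fs" "D = Fs ! l"
      using Fs(1) by (metis in_set_conv_nth)
    with D(4) mono[of j l] have "l < j"
      by (meson linorder_not_less)
    with D l show ?thesis by blast
  qed
  with Fs show ?thesis
    unfolding shellable_def shelling_def by blast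
qed

section \<open>Facets of the independence complex of a lexicographic product\<close>

abbreviation graph_facets :: "'a pair_pre_digraph \<Rightarrow> 'a set set" where
  "graph_facets G \<equiv> facets (independence_complex G)"

lemma graph_facets_iff:
  "F \<in> graph_facets G \<longleftrightarrow>
     independent_set G F \<and> (\<forall>u. independent_set G (insert u F) \<longrightarrow> u \<in> F)"
proof
  assume F: "F \<in> graph_facets G"
  then have "independent_set G F" "\<And>E. independent_set G E \<Longrightarrow> F \<subseteq> E \<Longrightarrow> E = F"
    by (auto simp: facets_def independence_complex_def)
  then show "independent_set G F \<and> (\<forall>u. independent_set G (insert u F) \<longrightarrow> u \<in> F)"
    by (metis insertI1 subset_insertI)
next
  assume R: "independent_set G F \<and> (\<forall>u. independent_set G (insert u F) \<longrightarrow> u \<in> F)"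
  have "u \<in> F" if "independent_set G E" "F \<subseteq> E" "u \<in> E" for u E
  proof -
    have "insert u F \<subseteq> E" using that by simp
    with that(1) have "independent_set G (insert u F)"
      unfolding independent_set_def by (meson subset_iff)
    with R show ?thesis by blast
  qed
  with R show "F \<in> graph_facets G"
    by (auto simp: facets_def independence_complex_def)
qed

lemma graph_facets_subset_eq:
  assumes "E \<in> graph_facets G" "F \<in> graph_facets G" "E \<subseteq> F"
  shows "E = F"
  using assms unfolding facets_def by blast

lemma graph_facet_subset:
  assumes "F \<in> graph_facets G"
  shows "F \<subseteq> pverts G"
  using assms unfolding facets_def independence_complex_def independent_set_def by blast

lemma independent_set_extends_to_facet:
  assumes "finite (pverts G)" "independent_set G S"
  obtains F where "F \<in> graph_facets G" "S \<subseteq> F"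
proof -
  have "independence_complex G \<subseteq> Pow (pverts G)"
    by (auto simp: independence_complex_def independent_set_def)
  then have "finite (independence_complex G)"
    using assms(1) by (simp add: finite_subset)
  moreover have "S \<in> independence_complex G"
    using assms(2) by (simp add: independence_complex_def)
  ultimately obtain F where F: "F \<in> independence_complex G" "S \<subseteq> F"
      "\<forall>E\<in>independence_complex G. F \<subseteq> E \<longrightarrow> F = E"
    by (rule finite_has_maximal2[elim_format]) blast
  have "E = F" if "E \<in> independence_complex G" "F \<subseteq> E" for E
    using F(3) that by metis
  with F(1) have "F \<in> graph_facets G"
    unfolding facets_def by simp
  then show ?thesis
    using F(2) by (rule that)
qed

lemma finite_graph_facets:
  assumes "finite (pverts G)"
  shows "finite (graph_facets G)"
  by (rule finite_subset[of _ "Pow (pverts G)"])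
    (use assms in \<open>auto simp: facets_def independence_complex_def independent_set_def\<close>)

lemma nonempty_graph_finite: "nonempty_graph G \<Longrightarrow> finite (pverts G)"
  unfolding nonempty_graph_def pair_graph_def pair_digraph_def
  by (auto dest: pair_fin_digraph.pair_finite_verts)

lemma nonempty_graph_no_loop: "nonempty_graph G \<Longrightarrow> (v, v) \<notin> parcs G"
  unfolding nonempty_graph_def pair_graph_def pair_digraph_def
  by (auto dest: pair_loopfree_digraph.pair_no_loops)

lemma independent_set_singleton:
  "nonempty_graph G \<Longrightarrow> v \<in> pverts G \<Longrightarrow> independent_set G {v}"
  by (simp add: independent_set_def nonempty_graph_no_loop)

lemma graph_facet_nonempty:
  assumes "nonempty_graph G" "F \<in> graph_facets G"
  shows "F \<noteq> {}"
proof
  assume "F = {}"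
  moreover obtain v where "v \<in> pverts G"
    using assms(1) by (auto simp: nonempty_graph_def)
  ultimately show False
    using assms independent_set_singleton[of G v] by (auto simp: graph_facets_iff)
qed

text \<open>
  Two points of \<open>D\<close> are adjacent through \<open>G\<close>, which the projection sees, or inside one \<open>H x\<close>, which
  the fibre sees. A loop of \<open>G\<close> at \<open>x\<close> would be a loop of the product at every point over \<open>x\<close>, so the
  two sides agree on loops as well.
\<close>

lemma independent_set_lex_product_iff:
  "independent_set (lex_product G H) D \<longleftrightarrow>
     independent_set G (Domain D) \<and> (\<forall>x\<in>Domain D. independent_set (H x) (D `` {x}))"
proof -
  have arc: "((x, y), (x', y')) \<in> parcs (lex_product G H) \<longleftrightarrow>
      x \<in> pverts G \<and> y \<in> pverts (H x) \<and> x' \<in> pverts G \<and> y' \<in> pverts (H x') \<and>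
      (x = x' \<and> (y, y') \<in> parcs (H x) \<or> (x, x') \<in> parcs G)" for x y x' y'
    by (auto simp: lex_product_def Let_def)
  have verts: "pverts (lex_product G H) = (SIGMA x : pverts G. pverts (H x))"
    by (simp add: lex_product_def Let_def)
  have sub: "D \<subseteq> (SIGMA x : pverts G. pverts (H x)) \<longleftrightarrow>
      Domain D \<subseteq> pverts G \<and> (\<forall>x\<in>Domain D. D `` {x} \<subseteq> pverts (H x))"
    by (auto simp: subset_iff)
  show ?thesis
  proof
    assume L: "independent_set (lex_product G H) D"
    then have D: "D \<subseteq> (SIGMA x : pverts G. pverts (H x))"
      by (simp add: independent_set_def verts)
    have no_arc: "\<not> (x = x' \<and> (y, y') \<in> parcs (H x) \<or> (x, x') \<in> parcs G)"
      if "(x, y) \<in> D" "(x', y') \<in> D" for x y x' y'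
      using L D that arc[of x y x' y'] unfolding independent_set_def by blast
    show "independent_set G (Domain D) \<and> (\<forall>x\<in>Domain D. independent_set (H x) (D `` {x}))"
      using D no_arc unfolding independent_set_def sub by blast
  next
    assume R: "independent_set G (Domain D) \<and> (\<forall>x\<in>Domain D. independent_set (H x) (D `` {x}))"
    then have "((x, y), (x', y')) \<notin> parcs (lex_product G H)"
      if "(x, y) \<in> D" "(x', y') \<in> D" for x y x' y'
      using that unfolding arc independent_set_def by blast
    with R show "independent_set (lex_product G H) D"
      unfolding independent_set_def verts sub by auto
  qed
qed

text \<open>
  Adding a pair \<open>(u, w)\<close> to \<open>D\<close> either enlarges the projection or enlarges one fibre, so maximality
  of \<open>D\<close> splits into maximality of the projection and of the fibres. The factors have to be nonempty:
  over an empty \<open>H u\<close> the projection could not be enlarged by \<open>u\<close>.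
\<close>

lemma facet_lex_product_iff:
  assumes H: "\<forall>x \<in> pverts G. nonempty_graph (H x)"
  shows "D \<in> graph_facets (lex_product G H) \<longleftrightarrow>
    Domain D \<in> graph_facets G \<and> (\<forall>x\<in>Domain D. D `` {x} \<in> graph_facets (H x))"
    (is "?L \<longleftrightarrow> ?R")
proof
  assume L: ?L
  then have ind: "independent_set G (Domain D)"
    "\<And>x. x \<in> Domain D \<Longrightarrow> independent_set (H x) (D `` {x})"
    and max: "\<And>u. independent_set (lex_product G H) (insert u D) \<Longrightarrow> u \<in> D"
    unfolding graph_facets_iff independent_set_lex_product_iff by blast+
  have "u \<in> Domain D" if u: "independent_set G (insert u (Domain D))" for u
  proof (rule ccontr)
    assume new: "u \<notin> Domain D"
    have "u \<in> pverts G" using u by (simp add: independent_set_def)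
    with H have Hu: "nonempty_graph (H u)" by blast
    then obtain w where w: "w \<in> pverts (H u)"
      by (auto simp: nonempty_graph_def)
    have "independent_set (H u) {w}"
      using Hu w by (rule independent_set_singleton)
    moreover have "insert (u, w) D `` {x} = (if x = u then {w} else D `` {x})" for x
      using new by auto
    ultimately have "independent_set (lex_product G H) (insert (u, w) D)"
      using u ind by (auto simp: independent_set_lex_product_iff)
    then show False using max new by blast
  qed
  moreover have "w \<in> D `` {x}"
    if x: "x \<in> Domain D" and w: "independent_set (H x) (insert w (D `` {x}))" for x w
  proof -
    have "insert (x, w) D `` {y} = (if y = x then insert w (D `` {x}) else D `` {y})" for y
      by auto
    moreover have "Domain (insert (x, w) D) = Domain D"
      using x by auto
    ultimately have "independent_set (lex_product G H) (insert (x, w) D)"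
      using w ind by (auto simp: independent_set_lex_product_iff)
    then show ?thesis using max by blast
  qed
  ultimately show ?R
    using ind by (auto simp: graph_facets_iff)
next
  assume R: ?R
  have "(x, w) \<in> D" if "independent_set (lex_product G H) (insert (x, w) D)" for x w
  proof -
    have "independent_set G (insert x (Domain D))"
      "independent_set (H x) (insert (x, w) D `` {x})"
      using that by (auto simp: independent_set_lex_product_iff)
    moreover have "insert (x, w) D `` {x} = insert w (D `` {x})"
      by auto
    ultimately show ?thesis
      using R by (auto simp: graph_facets_iff)
  qed
  with R show ?L
    by (auto simp: graph_facets_iff independent_set_lex_product_iff)
qed

section \<open>Shellability of the factors\<close>

text \<open>
  Passing to the link of the fixed part would not do by itself: \<open>S - {x}\<close> may extend to facets of \<open>G\<close>
  that avoid \<open>x\<close>, so that the link has facets unrelated to \<open>H x\<close>. These are the facets treated in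
  the second case at the end of the proof.
\<close>

lemma shellable_factor:
  assumes G: "nonempty_graph G"
    and H: "\<forall>x \<in> pverts G. nonempty_graph (H x)"
    and shell: "shellable_graph (lex_product G H)"
    and x: "x \<in> pverts G"
  shows "shellable_graph (H x)"
proof -
  obtain r where inj: "inj_on r (graph_facets (lex_product G H))"
    and r: "shelling_rank r (graph_facets (lex_product G H))"
    using shellable_imp_inj_shelling_rank shell unfolding shellable_graph_def by blast
  obtain S where S: "S \<in> graph_facets G" and xS: "x \<in> S"
    using independent_set_extends_to_facet[OF nonempty_graph_finite[OF G]
        independent_set_singleton[OF G x]] by auto
  have SG: "S \<subseteq> pverts G"
    using S by (rule graph_facet_subset)
  have "\<exists>F. F \<in> graph_facets (H y)" if "y \<in> S" for y
  proof -
    have "finite (pverts (H y))"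
      using that SG H by (blast intro: nonempty_graph_finite)
    moreover have "independent_set (H y) {}"
      by (simp add: independent_set_def)
    ultimately show ?thesis
      by (rule independent_set_extends_to_facet) blast
  qed
  then obtain M where M: "\<And>y. y \<in> S \<Longrightarrow> M y \<in> graph_facets (H y)"
    by metis
  define emb where "emb F = (SIGMA y:S. if y = x then F else M y)" for F
  have facet_ne: "F \<noteq> {}" if "y \<in> S" "F \<in> graph_facets (H y)" for y F
    using that SG H graph_facet_nonempty by blast
  have emb_fibre: "emb F `` {y} = (if y \<in> S then if y = x then F else M y else {})" for F y
    by (auto simp: emb_def)
  have emb_facet: "emb F \<in> graph_facets (lex_product G H)" if F: "F \<in> graph_facets (H x)" for F
  proof -
    have "Domain (emb F) = S"
    proof -
      have "emb F `` {y} \<noteq> {} \<longleftrightarrow> y \<in> S" for y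
        using facet_ne[OF xS F] facet_ne[OF _ M, of y] unfolding emb_fibre by simp
      then show ?thesis
        by (auto simp: Image_singleton)
    qed
    moreover have "emb F `` {y} \<in> graph_facets (H y)" if "y \<in> S" for y
      using M F that unfolding emb_fibre by simp
    ultimately show ?thesis
      unfolding facet_lex_product_iff[OF H] using S by simp
  qed
  have emb_surj: "D = emb (D `` {x}) \<and> D `` {x} \<in> graph_facets (H x)"
    if D: "D \<in> graph_facets (lex_product G H)" "x \<in> Domain D"
      and sub: "\<And>y. y \<in> S - {x} \<Longrightarrow> M y \<subseteq> D `` {y}" for D
  proof -
    have fib: "Domain D \<in> graph_facets G" "\<And>y. y \<in> Domain D \<Longrightarrow> D `` {y} \<in> graph_facets (H y)"
      using D(1) unfolding facet_lex_product_iff[OF H] by blast+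
    have "S \<subseteq> Domain D"
    proof
      fix y assume "y \<in> S"
      show "y \<in> Domain D"
      proof (cases "y = x")
        case False
        with \<open>y \<in> S\<close> have "M y \<noteq> {}" "M y \<subseteq> D `` {y}"
          using facet_ne M sub by blast+
        then show ?thesis by blast
      qed (use D(2) in simp)
    qed
    then have dom: "Domain D = S"
      using graph_facets_subset_eq[OF S fib(1)] by simp
    have "D `` {y} = M y" if "y \<in> S - {x}" for y
      using graph_facets_subset_eq[OF M fib(2) sub, of y] that dom by simp
    moreover have "D `` {y} = {}" if "y \<notin> S" for y
      using that dom by blast
    ultimately have "D `` {y} = emb (D `` {x}) `` {y}" for y
      unfolding emb_fibre by simp
    then have "D = emb (D `` {x})"
      by (simp add: set_eq_iff)
    then show ?thesis
      using fib(2)[OF D(2)] by blast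
  qed
  have "shelling_rank (\<lambda>F. r (emb F)) (graph_facets (H x))"
    unfolding shelling_rank_def
  proof (intro ballI impI, elim conjE)
    fix E F
    assume EF: "E \<in> graph_facets (H x)" "F \<in> graph_facets (H x)" "E \<noteq> F"
      and le: "r (emb E) \<le> r (emb F)"
    have ne: "emb E \<noteq> emb F"
      using EF(3) emb_fibre[of E x] emb_fibre[of F x] xS by metis
    obtain v D where v: "v \<in> emb F" "v \<notin> emb E" and D: "D \<in> graph_facets (lex_product G H)"
        "r D < r (emb F)" and diff: "emb F - D = {v}"
      using shelling_rankE[OF r emb_facet[OF EF(1)] emb_facet[OF EF(2)] ne le] .
    have "fst v = x \<and> snd v \<in> F \<and> snd v \<notin> E"
      using v by (cases v) (auto simp: emb_def split: if_splits)
    then obtain w where w: "v = (x, w)" "w \<in> F" "w \<notin> E"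
      by (cases v) simp
    have "(x, u) \<in> emb F - D \<longleftrightarrow> u \<in> F - D `` {x}" for u
      using xS by (simp add: emb_def)
    then have FD: "F - D `` {x} = {w}"
      unfolding diff w(1) by auto
    show "\<exists>v \<in> F - E. \<exists>D\<in>graph_facets (H x). r (emb D) < r (emb F) \<and> F - D = {v}"
    proof (cases "x \<in> Domain D")
      case True
      have "M y \<subseteq> D `` {y}" if "y \<in> S - {x}" for y
        using diff w(1) that by (auto simp: emb_def)
      with emb_surj[OF D(1) True] have "D = emb (D `` {x})" "D `` {x} \<in> graph_facets (H x)"
        by blast+
      then show ?thesis
        using D(2) FD w by (intro bexI[of _ w] bexI[of _ "D `` {x}"]) auto
    next
      case False
      \<comment> \<open>Then \<open>F\<close> is the single point \<open>w\<close>, so \<open>E\<close> itself can replace \<open>D\<close>.\<close>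
      then have "F = {w}"
        using FD by auto
      moreover have "r (emb E) < r (emb F)"
        using le ne inj_onD[OF inj _ emb_facet[OF EF(1)] emb_facet[OF EF(2)]] by linarith
      ultimately show ?thesis
        using w EF(1) by blast
    qed
  qed
  moreover have "finite (graph_facets (H x))"
    using H x finite_graph_facets nonempty_graph_finite by blast
  ultimately show ?thesis
    unfolding shellable_graph_def by (metis shelling_rank_imp_shellable)
qed

section \<open>Products over totally disconnected graphs\<close>

text \<open>
  If \<open>r E \<le> r F\<close> for two different families, then in some component where they differ the rank of \<open>E\<close>
  is at most that of \<open>F\<close>, since otherwise the sum for \<open>E\<close> would be larger. The shelling of this one
  component provides the required vertex, and replacing the fibre of \<open>F\<close> there provides the earlier
  facet.
\<close>

lemma shellable_disjoint_union:
  assumes G: "nonempty_graph G"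
    and H: "\<forall>x \<in> pverts G. nonempty_graph (H x)"
    and disc: "totally_disconnected G"
    and shell: "\<forall>x \<in> pverts G. shellable_graph (H x)"
  shows "shellable_graph (lex_product G H)"
proof -
  let ?V = "pverts G"
  have finV: "finite ?V"
    using G by (rule nonempty_graph_finite)
  have "\<forall>x\<in>?V. \<exists>r. shelling_rank r (graph_facets (H x))"
    using shell shellable_imp_inj_shelling_rank unfolding shellable_graph_def by metis
  then obtain \<rho> where \<rho>: "\<And>x. x \<in> ?V \<Longrightarrow> shelling_rank (\<rho> x) (graph_facets (H x))"
    by metis
  define r where "r D = (\<Sum>x\<in>?V. \<rho> x (D `` {x}))" for D
  have "S \<in> graph_facets G \<longleftrightarrow> S = ?V" for S
    using disc by (auto simp: graph_facets_iff independent_set_def totally_disconnected_def)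
  then have facet: "D \<in> graph_facets (lex_product G H) \<longleftrightarrow>
      Domain D = ?V \<and> (\<forall>x\<in>?V. D `` {x} \<in> graph_facets (H x))" for D
    using facet_lex_product_iff[OF H] by auto
  have "shelling_rank r (graph_facets (lex_product G H))"
    unfolding shelling_rank_def
  proof (intro ballI impI, elim conjE)
    fix E F
    assume E: "E \<in> graph_facets (lex_product G H)" and F: "F \<in> graph_facets (lex_product G H)"
      and "E \<noteq> F" and le: "r E \<le> r F"
    have "\<exists>y. E `` {y} \<noteq> F `` {y}"
      using \<open>E \<noteq> F\<close> by auto
    then obtain y where "E `` {y} \<noteq> F `` {y}" ..
    moreover from this have "y \<in> ?V"
      using E F facet by blast
    ultimately have y: "y \<in> ?V" "E `` {y} \<noteq> F `` {y}" by blast+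
    have "\<exists>x\<in>?V. E `` {x} \<noteq> F `` {x} \<and> \<rho> x (E `` {x}) \<le> \<rho> x (F `` {x})"
    proof (rule ccontr)
      assume "\<not> ?thesis"
      then have less: "\<rho> x (F `` {x}) < \<rho> x (E `` {x})" if "x \<in> ?V" "E `` {x} \<noteq> F `` {x}" for x
        using that by (meson not_le)
      have "r F < r E"
        unfolding r_def
        by (rule sum_strict_mono_ex1[OF finV]) (use less y in \<open>metis less_imp_le order_refl\<close>)+
      with le show False by simp
    qed
    then obtain x where x: "x \<in> ?V" "E `` {x} \<noteq> F `` {x}" "\<rho> x (E `` {x}) \<le> \<rho> x (F `` {x})"
      by blast
    then obtain w D where w: "w \<in> F `` {x}" "w \<notin> E `` {x}" and D: "D \<in> graph_facets (H x)"
      "\<rho> x D < \<rho> x (F `` {x})" "F `` {x} - D = {w}"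
      using shelling_rankE[OF \<rho>[OF x(1)], of "E `` {x}" "F `` {x}"] E F facet by metis
    define D' where "D' = (SIGMA y:?V. if y = x then D else F `` {y})"
    have fib: "D' `` {y} = (if y = x then D else F `` {y})" if "y \<in> ?V" for y
      using that by (auto simp: D'_def)
    have "D \<noteq> {}"
      using D(1) H x(1) graph_facet_nonempty by blast
    moreover have "F `` {y} \<noteq> {}" if "y \<in> ?V" for y
      using F that unfolding facet by blast
    ultimately have "D' `` {y} \<noteq> {}" if "y \<in> ?V" for y
      using that by (simp add: fib)
    then have "?V \<subseteq> Domain D'"
      by blast
    moreover have "Domain D' \<subseteq> ?V"
      by (auto simp: D'_def)
    ultimately have "D' \<in> graph_facets (lex_product G H)"
      using D(1) F unfolding facet by (simp add: fib)
    moreover have "r D' < r F"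
      unfolding r_def
      by (rule sum_strict_mono_ex1[OF finV]) (use D(2) x(1) in \<open>auto simp: fib\<close>)
    moreover have "F - D' = {(x, w)}"
    proof -
      have "Domain F = ?V"
        using F unfolding facet by blast
      then have "(y, u) \<in> F - D' \<longleftrightarrow> y = x \<and> u \<in> F `` {x} - D" for y u
        using x(1) by (auto simp: D'_def)
      then show ?thesis
        unfolding D(3) by auto
    qed
    ultimately show "\<exists>v \<in> F - E. \<exists>D\<in>graph_facets (lex_product G H). r D < r F \<and> F - D = {v}"
      using w by blast
  qed
  moreover have "nonempty_graph (lex_product G H)"
    using nonempty_graph_lex_product G H by blast
  ultimately show ?thesis
    unfolding shellable_graph_def
    by (meson finite_graph_facets nonempty_graph_finite shelling_rank_imp_shellable)
qed

section \<open>Edges of the first factor\<close>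

text \<open>
  For an edge \<open>(x, y)\<close>, the facets wide over \<open>x\<close> and those wide over \<open>y\<close> are two families that no
  shelling can start simultaneously: each of them, if nonempty, must contain the first facet.
\<close>

definition wide_over :: "'a \<Rightarrow> ('a \<times> 'b) set \<Rightarrow> bool" where
  "wide_over x F \<longleftrightarrow> (\<exists>a b. (x, a) \<in> F \<and> (x, b) \<in> F \<and> a \<noteq> b)"

lemma wide_over_facet_exists:
  assumes G: "nonempty_graph G"
    and H: "\<forall>x \<in> pverts G. nonempty_graph (H x)"
    and x: "x \<in> pverts G"
    and nc: "\<not> complete_graph (H x)"
  obtains F where "F \<in> graph_facets (lex_product G H)" "wide_over x F"
proof -
  have "nonempty_graph (H x)" using H x by blast
  then interpret Hx: pair_graph "H x" by (simp add: nonempty_graph_def)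
  obtain a b where ab: "a \<in> pverts (H x)" "b \<in> pverts (H x)" "a \<noteq> b" "(a, b) \<notin> parcs (H x)"
  proof -
    have "parcs (H x) \<noteq> {(u, v). (u, v) \<in> pverts (H x) \<times> pverts (H x) \<and> u \<noteq> v}"
      using nc Hx.pair_finite_verts unfolding complete_graph_def complete_digraph_pair_def by blast
    moreover have "parcs (H x) \<subseteq> {(u, v). (u, v) \<in> pverts (H x) \<times> pverts (H x) \<and> u \<noteq> v}"
      using Hx.in_arcsD1 Hx.in_arcsD2 Hx.pair_no_loops by fastforce
    ultimately show ?thesis using that by blast
  qed
  then have "(b, a) \<notin> parcs (H x)"
    using Hx.arcs_symmetric by blast
  with ab have "independent_set (H x) {a, b}"
    by (auto simp: independent_set_def dest: Hx.pair_no_loops)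
  moreover have "Domain {(x, a), (x, b)} = {x}" "{(x, a), (x, b)} `` {x} = {a, b}"
    by auto
  ultimately have "independent_set (lex_product G H) {(x, a), (x, b)}"
    using independent_set_singleton[OF G x] by (simp add: independent_set_lex_product_iff)
  moreover have "finite (pverts (lex_product G H))"
    using nonempty_graph_lex_product G H nonempty_graph_finite by blast
  ultimately obtain F where "F \<in> graph_facets (lex_product G H)" "{(x, a), (x, b)} \<subseteq> F"
    using independent_set_extends_to_facet by metis
  with ab(3) show ?thesis
    using that unfolding wide_over_def by blast
qed

text \<open>
  The two facets share a point \<open>(x, c)\<close>. If it were the only point of \<open>D\<close> over \<open>x\<close>, then \<open>{c}\<close> would be
  a facet of \<open>H x\<close> properly contained in the facet \<open>F `` {x}\<close>.
\<close>

lemma wide_over_adjacent_facet: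
  assumes H: "\<forall>x \<in> pverts G. nonempty_graph (H x)"
    and F: "F \<in> graph_facets (lex_product G H)" "wide_over x F"
    and D: "D \<in> graph_facets (lex_product G H)" "F - D = {v}"
  shows "wide_over x D"
proof -
  obtain a b where ab: "(x, a) \<in> F" "(x, b) \<in> F" "a \<noteq> b"
    using F(2) unfolding wide_over_def by blast
  have "(x, a) \<in> D \<or> (x, b) \<in> D"
    using ab D(2) by (metis DiffI Pair_inject singletonD)
  then obtain c where c: "(x, c) \<in> D" "(x, c) \<in> F"
    using ab by blast
  show ?thesis
  proof (rule ccontr)
    assume "\<not> wide_over x D"
    then have "D `` {x} = {c}"
      using c unfolding wide_over_def by blast
    moreover have "D `` {x} \<in> graph_facets (H x)" "F `` {x} \<in> graph_facets (H x)"
      using F(1) D(1) c by (auto simp: facet_lex_product_iff[OF H])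
    ultimately have "F `` {x} = {c}"
      using graph_facets_subset_eq[of "D `` {x}" "H x" "F `` {x}"] c by auto
    moreover have "a \<in> F `` {x}" "b \<in> F `` {x}"
      using ab by simp_all
    ultimately show False
      using ab(3) by simp
  qed
qed

lemma shellable_edge_complete:
  assumes G: "nonempty_graph G"
    and H: "\<forall>x \<in> pverts G. nonempty_graph (H x)"
    and shell: "shellable_graph (lex_product G H)"
    and edge: "(x, y) \<in> parcs G"
  shows "complete_graph (H x) \<or> complete_graph (H y)"
proof (rule ccontr)
  assume nc: "\<not> ?thesis"
  interpret G: pair_graph G using G by (simp add: nonempty_graph_def)
  have xy: "x \<in> pverts G" "y \<in> pverts G"
    using edge G.in_arcsD1 G.in_arcsD2 by auto
  obtain r where r: "shelling_rank r (graph_facets (lex_product G H))"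
    using shellable_imp_inj_shelling_rank shell unfolding shellable_graph_def by blast
  have first: "\<exists>F \<in> graph_facets (lex_product G H). wide_over z F \<and>
      (\<forall>D \<in> graph_facets (lex_product G H). wide_over z D \<longrightarrow> r F \<le> r D)"
    if z: "z \<in> pverts G" "\<not> complete_graph (H z)" for z
  proof -
    obtain F where "F \<in> graph_facets (lex_product G H) \<and> wide_over z F"
      using wide_over_facet_exists[OF G H z] by blast
    from ex_has_least_nat[of "\<lambda>F. F \<in> graph_facets (lex_product G H) \<and> wide_over z F", OF this]
    show ?thesis by blast
  qed
  have no_earlier: "E = F"
    if E: "E \<in> graph_facets (lex_product G H)" and le: "r E \<le> r F"
      and F: "F \<in> graph_facets (lex_product G H)" "wide_over z F"
      and min: "\<forall>D \<in> graph_facets (lex_product G H). wide_over z D \<longrightarrow> r F \<le> r D"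
    for E F z
  proof (rule ccontr)
    assume "E \<noteq> F"
    from shelling_rankE[OF r E F(1) this le] obtain v D where
      D: "D \<in> graph_facets (lex_product G H)" "r D < r F" "F - D = {v}" .
    then have "wide_over z D"
      using wide_over_adjacent_facet[OF H F] by blast
    with D min show False by fastforce
  qed
  obtain E where E: "E \<in> graph_facets (lex_product G H)" "wide_over x E"
      "\<forall>D \<in> graph_facets (lex_product G H). wide_over x D \<longrightarrow> r E \<le> r D"
    using first[OF xy(1)] nc by blast
  obtain F where F: "F \<in> graph_facets (lex_product G H)" "wide_over y F"
      "\<forall>D \<in> graph_facets (lex_product G H). wide_over y D \<longrightarrow> r F \<le> r D"
    using first[OF xy(2)] nc by blast
  have "E = F"
    using no_earlier[OF E(1) _ F] no_earlier[OF F(1) _ E] by (metis linear)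
  then have "x \<in> Domain F" "y \<in> Domain F"
    using E(2) F(2) unfolding wide_over_def by blast+
  moreover have "independent_set G (Domain F)"
    using F(1) unfolding graph_facets_iff independent_set_lex_product_iff by blast
  ultimately show False
    using edge unfolding independent_set_def by blast
qed

section \<open>The combined statement\<close>

theorem theorem2p13:
  fixes G :: "'a pair_pre_digraph"
    and H :: "'a \<Rightarrow> 'b pair_pre_digraph"
  assumes "nonempty_graph G"
    and "\<forall>x \<in> pverts G. nonempty_graph (H x)"
  shows "(totally_disconnected G \<longrightarrow>
            (shellable_graph (lex_product G H) \<longleftrightarrow> (\<forall>x \<in> pverts G. shellable_graph (H x))))
       \<and> (shellable_graph (lex_product G H) \<longrightarrow> (\<forall>x \<in> pverts G. shellable_graph (H x)))
       \<and> (shellable_graph (lex_product G H) \<longrightarrow>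
            (\<forall>x y. (x, y) \<in> parcs G \<longrightarrow> complete_graph (H x) \<or> complete_graph (H y)))"
  using shellable_factor[OF assms] shellable_disjoint_union[OF assms]
    shellable_edge_complete[OF assms] by blast

end
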